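(* There exists a continuous map $f\colon[0,1]\to[0,1]$ with the following properties. (1) (a) $f$ is not topologically conjugate to any of the maps $f_a$, $a\in(0,1]$, defined in the context; (b) $h_{\mathrm{top}}(f)=+\infty$; (c) $f$ is not expansive, not $h$-expansive and not asymptotically $h$-expansive. (2) $f$ satisfies the little Zygmund condition.
   Context: Little Zygmund condition: a continuous function $f$ on $[0,1]$ satisfies the little Zygmund condition if, for all $x\in(0,1)$, $|f(x+t)+f(x-t)-2f(x)|=o(t)$ as $t\to 0$. The maps $f_a$, $a\in(0,1]$: for a positive integer $b$ and $k=0,\dots,b-1$ let $J_{b,k}=[\frac kb,\frac{k+1}b]$, and let $g_{1,b}\colon[0,1]\to[0,1]$ be $g_{1,b}(x)=bx-k$ for $x\in J_{b,k}$, $k$ even, and $g_{1,b}(x)=(k+1)-bx$ for $x\in J_{b,k}$, $k$ odd. Let $\varphi_a(x)=x^a$ on $[0,1]$ and $g_{a,b}=\varphi_a\circ g_{1,b}\circ\varphi_a^{-1}$. For $n\ge1$ let $I_n=(2^{-n},2^{-n+1}]$ and let $A_{I_n}$ be the orientation-preserving affine bijection from the closure of $I_n$ onto $[0,1]$. Then $f_a(0)=0$ and $f_a(x)=A_{I_n}^{-1}\circ g_{a,2n+1}\circ A_{I_n}(x)$ for $x\in I_n$, $n\ge1$. (All these $f_a$ are topologically conjugate to one another.) Let $f$ be a continuous self-map of a compact metric space $(X,d)$. Put $d_n^f(x,y)=\max_{0\le k<n}d(f^k(x),f^k(y))$. A set $E$ $(n,\delta)$-spans $F$ if for every $x\in F$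 there is $y\in E$ with $d_n^f(x,y)<\delta$; $r_f(n,\delta;F)$ is the minimal cardinality of a set that $(n,\delta)$-spans $F$. For $K\subset X$ compact, $r_f(\delta;K)=\limsup_{n\to\infty}\frac1n\log r_f(n,\delta;K)$ and $h(f;K)=\lim_{\delta\to0}r_f(\delta;K)$. The topological entropy is $h_{\mathrm{top}}(f)=\sup_K h(f;K)=h(f;X)$. For $\epsilon>0$ and $x\in X$ let $\Phi_\epsilon(x)=\{y: d(f^n(x),f^n(y))\le\epsilon\ \forall n\ge0\}$ and $h_f^*(\epsilon)=\sup_{x\in X}h(f;\Phi_\epsilon(x))$. The map $f$ is expansive if there is $\epsilon>0$ such that for all $x,y\in X$, $d(f^k(x),f^k(y))<\epsilon$ for all $k\in\mathbb{N}$ implies $x=y$; it is $h$-expansive if $h_f^*(\epsilon)=0$ for some $\epsilon>0$; it is asymptotically $h$-expansive if $\lim_{\epsilon\to0}h_f^*(\epsilon)=0$. *)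

theory Defs
  imports "HOL-Analysis.Analysis" "HOL-Library.Landau_Symbols"
begin

section \<open>Topological entropy and expansiveness\<close>

text \<open>
  A dynamical system is given by a compact set \<open>X\<close> in a metric space and a map \<open>f\<close> that is
  continuous on \<open>X\<close> and maps \<open>X\<close> into itself; the values of \<open>f\<close> outside \<open>X\<close> play no role.
  The cardinality \<open>span_card\<close> is meant for \<open>n \<ge> 1\<close> and compact \<open>K \<subseteq> X\<close>; in that case finite
  spanning sets exist, see \<open>finite_span_exists\<close>. The case \<open>n = 0\<close> does not affect the limit
  superior.
\<close>

definition bowen_dist :: "('a::metric_space \<Rightarrow> 'a) \<Rightarrow> nat \<Rightarrow> 'a \<Rightarrow> 'a \<Rightarrow> real" where
  "bowen_dist f n x y = Max ((\<lambda>k. dist ((f ^^ k) x) ((f ^^ k) y)) ` {..<n})"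

definition spans ::
  "('a::metric_space \<Rightarrow> 'a) \<Rightarrow> nat \<Rightarrow> real \<Rightarrow> 'a set \<Rightarrow> 'a set \<Rightarrow> bool" where
  "spans f n \<delta> E F \<longleftrightarrow> (\<forall>x\<in>F. \<exists>y\<in>E. bowen_dist f n x y < \<delta>)"

definition span_card ::
  "'a set \<Rightarrow> ('a::metric_space \<Rightarrow> 'a) \<Rightarrow> nat \<Rightarrow> real \<Rightarrow> 'a set \<Rightarrow> nat" where
  "span_card X f n \<delta> F = (LEAST m. \<exists>E\<subseteq>X. finite E \<and> card E = m \<and> spans f n \<delta> E F)"

definition span_rate ::
  "'a set \<Rightarrow> ('a::metric_space \<Rightarrow> 'a) \<Rightarrow> real \<Rightarrow> 'a set \<Rightarrow> ereal" where
  "span_rate X f \<delta> K = limsup (\<lambda>n. ereal (1 / real n * ln (real (span_card X f n \<delta> K))))"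

text \<open>The limit exists for compact \<open>K \<subseteq> X\<close>, see \<open>tendsto_entropy_on\<close>.\<close>

definition entropy_on :: "'a set \<Rightarrow> ('a::metric_space \<Rightarrow> 'a) \<Rightarrow> 'a set \<Rightarrow> ereal" where
  "entropy_on X f K = Lim (at_right 0) (\<lambda>\<delta>. span_rate X f \<delta> K)"

definition top_entropy :: "'a set \<Rightarrow> ('a::metric_space \<Rightarrow> 'a) \<Rightarrow> ereal" where
  "top_entropy X f = (SUP K\<in>{K. K \<subseteq> X \<and> compact K}. entropy_on X f K)"

definition Phi :: "'a set \<Rightarrow> ('a::metric_space \<Rightarrow> 'a) \<Rightarrow> real \<Rightarrow> 'a \<Rightarrow> 'a set" where
  "Phi X f \<epsilon> x = {y\<in>X. \<forall>n. dist ((f ^^ n) x) ((f ^^ n) y) \<le> \<epsilon>}"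

text \<open>
  The sets \<open>Phi X f \<epsilon> x\<close> are closed in \<open>X\<close> and hence compact, so \<open>entropy_on\<close> is applied
  only to compact sets here.
\<close>

definition local_entropy :: "'a set \<Rightarrow> ('a::metric_space \<Rightarrow> 'a) \<Rightarrow> real \<Rightarrow> ereal" where
  "local_entropy X f \<epsilon> = (SUP x\<in>X. entropy_on X f (Phi X f \<epsilon> x))"

definition expansive :: "'a set \<Rightarrow> ('a::metric_space \<Rightarrow> 'a) \<Rightarrow> bool" where
  "expansive X f \<longleftrightarrow>
     (\<exists>\<epsilon>>0. \<forall>x\<in>X. \<forall>y\<in>X. (\<forall>k. dist ((f ^^ k) x) ((f ^^ k) y) < \<epsilon>) \<longrightarrow> x = y)"

definition h_expansive :: "'a set \<Rightarrow> ('a::metric_space \<Rightarrow> 'a) \<Rightarrow> bool" where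
  "h_expansive X f \<longleftrightarrow> (\<exists>\<epsilon>>0. local_entropy X f \<epsilon> = 0)"

definition asymptotically_h_expansive :: "'a set \<Rightarrow> ('a::metric_space \<Rightarrow> 'a) \<Rightarrow> bool" where
  "asymptotically_h_expansive X f \<longleftrightarrow> (local_entropy X f \<longlongrightarrow> 0) (at_right 0)"

lemma finite_span_exists:
  fixes f :: "'a::metric_space \<Rightarrow> 'a"
  assumes f: "continuous_on X f" "f ` X \<subseteq> X" and K: "compact K" "K \<subseteq> X"
    and n: "n \<ge> 1" and \<delta>: "\<delta> > 0"
  shows "\<exists>E\<subseteq>X. finite E \<and> spans f n \<delta> E K"
proof -
  have iter: "continuous_on X (f ^^ k) \<and> (f ^^ k) ` X \<subseteq> X" for k
  proof (induction k)
    case (Suc k)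
    have "continuous_on X (f \<circ> (f ^^ k))"
      using Suc f by (intro continuous_on_compose) (auto intro: continuous_on_subset)
    then show ?case using Suc f(2) by (auto simp: o_def)
  qed auto
  have "\<forall>k. \<exists>\<eta>>0. \<forall>x\<in>K. \<forall>y\<in>K. dist y x < \<eta> \<longrightarrow> dist ((f ^^ k) y) ((f ^^ k) x) < \<delta>"
  proof
    fix k
    have "uniformly_continuous_on K (f ^^ k)"
      using iter K by (blast intro: compact_uniformly_continuous continuous_on_subset)
    then show "\<exists>\<eta>>0. \<forall>x\<in>K. \<forall>y\<in>K. dist y x < \<eta> \<longrightarrow> dist ((f ^^ k) y) ((f ^^ k) x) < \<delta>"
      using \<delta> unfolding uniformly_continuous_on_def by blast
  qed
  then obtain \<eta> where \<eta>: "\<And>k. \<eta> k > 0"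
    "\<And>k x y. x \<in> K \<Longrightarrow> y \<in> K \<Longrightarrow> dist y x < \<eta> k \<Longrightarrow> dist ((f ^^ k) y) ((f ^^ k) x) < \<delta>"
    by metis
  define e where "e = Min (\<eta> ` {..<n})"
  have "e > 0" using n \<eta>(1) by (auto simp: e_def Min_gr_iff lessThan_empty_iff)
  then obtain E where E: "finite E" "E \<subseteq> K" "K \<subseteq> (\<Union>x\<in>E. ball x e)"
    using K(1) seq_compact_imp_totally_bounded compact_imp_seq_compact by metis
  have "spans f n \<delta> E K"
    unfolding spans_def
  proof
    fix x assume x: "x \<in> K"
    then obtain y where y: "y \<in> E" "dist x y < e"
      using E(3) by (auto simp: dist_commute)
    have "dist ((f ^^ k) x) ((f ^^ k) y) < \<delta>" if "k < n" for k
    proof -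
      have "e \<le> \<eta> k" using that by (auto simp: e_def)
      then show ?thesis using \<eta>(2)[of y x k] x y E(2) by auto
    qed
    then have "bowen_dist f n x y < \<delta>"
      using n by (auto simp: bowen_dist_def Max_less_iff lessThan_empty_iff)
    then show "\<exists>y\<in>E. bowen_dist f n x y < \<delta>" using y(1) by blast
  qed
  then show ?thesis using E K by blast
qed

lemma span_card_antimono:
  fixes f :: "'a::metric_space \<Rightarrow> 'a"
  assumes "continuous_on X f" "f ` X \<subseteq> X" "compact K" "K \<subseteq> X"
    and "n \<ge> 1" "0 < \<delta>" "\<delta> \<le> \<delta>'"
  shows "span_card X f n \<delta>' K \<le> span_card X f n \<delta> K"
proof -
  let ?P = "\<lambda>\<delta> m. \<exists>E\<subseteq>X. finite E \<and> card E = m \<and> spans f n \<delta> E K"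
  have "\<exists>m. ?P \<delta> m" using finite_span_exists[of X f K n \<delta>] assms by blast
  then have "?P \<delta> (span_card X f n \<delta> K)"
    unfolding span_card_def by (rule LeastI_ex)
  then have "?P \<delta>' (span_card X f n \<delta> K)"
    using \<open>\<delta> \<le> \<delta>'\<close> unfolding spans_def by (meson order_less_le_trans)
  then show ?thesis unfolding span_card_def[of X f n \<delta>'] by (rule Least_le)
qed

lemma span_rate_antimono:
  fixes f :: "'a::metric_space \<Rightarrow> 'a"
  assumes "continuous_on X f" "f ` X \<subseteq> X" "compact K" "K \<subseteq> X" "0 < \<delta>" "\<delta> \<le> \<delta>'"
  shows "span_rate X f \<delta>' K \<le> span_rate X f \<delta> K"
  unfolding span_rate_def
proof (rule Limsup_mono, rule eventually_sequentiallyI[of 1])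
  fix n :: nat assume n: "1 \<le> n"
  have le: "span_card X f n \<delta>' K \<le> span_card X f n \<delta> K"
    using span_card_antimono[of X f K n \<delta> \<delta>'] assms n by blast
  have "ln (real (span_card X f n \<delta>' K)) \<le> ln (real (span_card X f n \<delta> K))"
  proof (cases "span_card X f n \<delta>' K = 0")
    case True
    then show ?thesis by (cases "span_card X f n \<delta> K = 0") auto
  next
    case False
    then show ?thesis using le by (intro ln_mono) auto
  qed
  then show "ereal (1 / real n * ln (real (span_card X f n \<delta>' K)))
      \<le> ereal (1 / real n * ln (real (span_card X f n \<delta> K)))"
    by (simp add: divide_right_mono)
qed

lemma tendsto_entropy_on:
  fixes f :: "'a::metric_space \<Rightarrow> 'a"
  assumes f: "continuous_on X f" "f ` X \<subseteq> X" and K: "compact K" "K \<subseteq> X"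
  shows "((\<lambda>\<delta>. span_rate X f \<delta> K) \<longlongrightarrow> entropy_on X f K) (at_right 0)"
proof -
  let ?S = "SUP \<delta>\<in>{0<..}. span_rate X f \<delta> K"
  have lim: "((\<lambda>\<delta>. span_rate X f \<delta> K) \<longlongrightarrow> ?S) (at_right 0)"
  proof (rule order_tendstoI)
    fix a assume "a < ?S"
    then obtain d where d: "d > 0" "a < span_rate X f d K" by (auto simp: less_SUP_iff)
    have "a < span_rate X f \<delta> K" if "0 < \<delta>" "\<delta> < d" for \<delta>
      using d(2) span_rate_antimono[OF f K that(1), of d] that by auto
    then show "\<forall>\<^sub>F \<delta> in at_right 0. a < span_rate X f \<delta> K"
      using d(1) unfolding eventually_at_right_field by blast
  next
    fix a assume a: "?S < a"
    have "span_rate X f \<delta> K < a" if "0 < \<delta>" for \<delta>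
      using a SUP_upper[of \<delta> "{0<..}" "\<lambda>\<delta>. span_rate X f \<delta> K"] that by auto
    then show "\<forall>\<^sub>F \<delta> in at_right 0. span_rate X f \<delta> K < a"
      unfolding eventually_at_right_field by (intro exI[of _ 1]) auto
  qed
  then have "entropy_on X f K = ?S"
    unfolding entropy_on_def by (intro tendsto_Lim) auto
  then show ?thesis using lim by simp
qed


section \<open>Topological conjugacy\<close>

definition top_conjugate ::
  "'a::topological_space set \<Rightarrow> ('a \<Rightarrow> 'a) \<Rightarrow> 'b::topological_space set \<Rightarrow> ('b \<Rightarrow> 'b) \<Rightarrow> bool" where
  "top_conjugate X f Y g \<longleftrightarrow>
     (\<exists>h h'. homeomorphism X Y h h' \<and> (\<forall>x\<in>X. h (f x) = g (h x)))"


section \<open>The little Zygmund condition\<close>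

definition little_zygmund :: "(real \<Rightarrow> real) \<Rightarrow> bool" where
  "little_zygmund f \<longleftrightarrow> continuous_on {0..1} f \<and>
     (\<forall>x\<in>{0<..<1}. (\<lambda>t. \<bar>f (x + t) + f (x - t) - 2 * f x\<bar>) \<in> o[at 0](\<lambda>t. t))"


section \<open>The model maps\<close>

text \<open>
  On \<open>[0,1]\<close> the integer \<open>k\<close> below is an index of a lap containing \<open>x\<close>, except that it
  equals \<open>b\<close> for \<open>x = 1\<close>, where the formula still gives the correct value; see
  \<open>zigzag_eq\<close>.
\<close>

definition zigzag :: "nat \<Rightarrow> real \<Rightarrow> real" where
  "zigzag b x = (let k = \<lfloor>real b * x\<rfloor> in
     if even k then real b * x - of_int k else (of_int k + 1) - real b * x)"

definition zigzag_pow :: "real \<Rightarrow> nat \<Rightarrow> real \<Rightarrow> real" where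
  "zigzag_pow a b x = (zigzag b (x powr (1 / a))) powr a"

definition dyadic_Ioc :: "nat \<Rightarrow> real set" where
  "dyadic_Ioc n = {2 powi (- int n) <.. 2 powi (- int n + 1)}"

definition dyadic_affine :: "nat \<Rightarrow> real \<Rightarrow> real" where
  "dyadic_affine n x = 2 ^ n * x - 1"

definition dyadic_affine_inv :: "nat \<Rightarrow> real \<Rightarrow> real" where
  "dyadic_affine_inv n y = (y + 1) / 2 ^ n"

definition model_map :: "real \<Rightarrow> real \<Rightarrow> real" where
  "model_map a x = (if x = 0 then 0 else
     (let n = (THE n. n \<ge> 1 \<and> x \<in> dyadic_Ioc n)
      in dyadic_affine_inv n (zigzag_pow a (2 * n + 1) (dyadic_affine n x))))"

lemma zigzag_eq:
  assumes "b > 0" "k < b" "x \<in> {real k / real b .. (real k + 1) / real b}"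
  shows "zigzag b x = (if even k then real b * x - real k else (real k + 1) - real b * x)"
proof -
  have bnd: "real k \<le> real b * x" "real b * x \<le> real k + 1"
    using assms by (auto simp: field_simps)
  show ?thesis
  proof (cases "real b * x = real k + 1")
    case True
    then have "\<lfloor>real b * x\<rfloor> = int k + 1" by simp
    then show ?thesis using True by (simp add: zigzag_def)
  next
    case False
    then have "\<lfloor>real b * x\<rfloor> = int k" using bnd by (simp add: floor_eq_iff)
    then show ?thesis by (simp add: zigzag_def)
  qed
qed

lemma powr_inverse_unit:
  fixes x a :: real
  assumes "a > 0" "x \<in> {0..1}"
  shows "(x powr a) powr (1 / a) = x" "(x powr (1 / a)) powr a = x"
    and "x powr a \<in> {0..1}" "x powr (1 / a) \<in> {0..1}"
  using assms by (auto simp: powr_powr powr_le1)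

lemma dyadic_Ioc_eq: "dyadic_Ioc n = {1 / 2 ^ n <.. 2 / 2 ^ n}"
proof -
  have "(2::real) powi (- int n) = 1 / 2 ^ n" by (simp add: power_int_minus divide_inverse)
  moreover have "(2::real) powi (- int n + 1) = 2 powi (- int n) * 2"
    by (rule power_int_add_1) simp
  ultimately show ?thesis by (simp add: dyadic_Ioc_def)
qed

lemma bij_betw_dyadic_affine:
  "bij_betw (dyadic_affine n) (closure (dyadic_Ioc n)) {0..1}"
  "strict_mono (dyadic_affine n)"
  "dyadic_affine_inv n (dyadic_affine n x) = x"
  "dyadic_affine n (dyadic_affine_inv n x) = x"
proof -
  show inv: "dyadic_affine_inv n (dyadic_affine n x) = x" 
    "dyadic_affine n (dyadic_affine_inv n x) = x" for x
    by (auto simp: dyadic_affine_def dyadic_affine_inv_def)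
  show "strict_mono (dyadic_affine n)"
    by (auto simp: strict_mono_def dyadic_affine_def)
  have "closure (dyadic_Ioc n) = {1 / 2 ^ n .. 2 / 2 ^ n}"
    by (simp add: dyadic_Ioc_eq divide_strict_right_mono)
  then show "bij_betw (dyadic_affine n) (closure (dyadic_Ioc n)) {0..1}"
    by (intro bij_betwI[where g = "dyadic_affine_inv n"])
      (auto simp: inv dyadic_affine_def dyadic_affine_inv_def field_simps)
qed

lemma dyadic_Ioc_unique:
  assumes "x \<in> dyadic_Ioc m" "x \<in> dyadic_Ioc n"
  shows "m = n"
proof -
  have "\<not> m < n" if "x \<in> dyadic_Ioc m" "x \<in> dyadic_Ioc n" for m n
  proof
    assume "m < n"
    then have "(2::real) powi (- int n + 1) \<le> 2 powi (- int m)"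
      by (intro power_int_increasing) auto
    then show False using that by (auto simp: dyadic_Ioc_def)
  qed
  then show ?thesis using assms by (meson linorder_neqE_nat)
qed

lemma model_map_eq:
  assumes "n \<ge> 1" "x \<in> dyadic_Ioc n"
  shows "model_map a x =
    dyadic_affine_inv n (zigzag_pow a (2 * n + 1) (dyadic_affine n x))"
proof -
  have "(THE n. n \<ge> 1 \<and> x \<in> dyadic_Ioc n) = n"
    using assms dyadic_Ioc_unique by (intro the_equality) blast+
  moreover have "x \<noteq> 0" using assms(2) by (auto simp: dyadic_Ioc_eq)
  ultimately show ?thesis by (simp add: model_map_def)
qed

end

theory Submission
  imports Defs
begin

text \<open>
  The witness is \<open>f x = x (1 - x) (1 + cos (\<pi> / x))\<close>, continued by \<open>f 0 = 0\<close>.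

  The little Zygmund condition is a condition at each interior point separately, and it holds at
  every point of differentiability, because there the terms linear in \<open>t\<close> cancel in the second
  difference. So all irregularity may be concentrated at the endpoint \<open>0\<close>, where only continuity
  is asked for; the envelope \<open>2 x (1 - x)\<close> provides it.

  The cosine oscillates faster and faster between \<open>0\<close> and the envelope as \<open>x\<close> tends to \<open>0\<close>:
  \<open>f\<close> vanishes at the points \<open>1 / k\<close> with \<open>k\<close> odd and touches the envelope at those with \<open>k\<close> even.
  The envelope lies so far above the diagonal near \<open>0\<close> that each of the \<open>m\<close> laps
  \<open>[1 / (2j + 1), 1 / (2j)]\<close>, \<open>2m \<le> j < 3m\<close>, is mapped over the whole interval
  \<open>[1 / (6m), 1 / (4m)]\<close> that contains them (\<open>lap_covers_window\<close>). This is a horseshoe with \<open>m\<close>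
  branches, so the points that never leave the interval carry entropy at least \<open>ln m\<close>
  (\<open>horseshoe_entropy\<close>). As the intervals shrink to \<open>0\<close>, arbitrarily large entropy is found in the
  sets \<open>Phi\<close> at every scale \<open>\<epsilon>\<close>: the local entropy is infinite for every \<open>\<epsilon> > 0\<close>, which refutes both
  forms of \<open>h\<close>-expansiveness, and the topological entropy is infinite too. Expansiveness fails
  already because the fixed points accumulate at \<open>0\<close>.

  Finally \<open>f \<le> 1 / 2\<close> on \<open>[0, 1]\<close>, whereas every model map is onto (\<open>model_map_surj\<close>);
  surjectivity is invariant under conjugacy.
\<close>

section \<open>Entropy of a horseshoe\<close>

lemma continuous_on_funpow:
  fixes f :: "'a::topological_space \<Rightarrow> 'a"
  assumes "continuous_on X f" "f ` X \<subseteq> X"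
  shows "continuous_on X (f ^^ n) \<and> (f ^^ n) ` X \<subseteq> X"
proof (induction n)
  case (Suc n)
  have "continuous_on X (f \<circ> (f ^^ n))"
    using Suc assms by (intro continuous_on_compose) (auto intro: continuous_on_subset)
  then show ?case using Suc assms(2) by (auto simp: o_def)
qed auto

lemma compact_Phi:
  fixes f :: "'a::metric_space \<Rightarrow> 'a"
  assumes "continuous_on X f" "f ` X \<subseteq> X" "compact X"
  shows "compact (Phi X f \<epsilon> x)"
proof -
  have "closed (X \<inter> (f ^^ n) -` cball ((f ^^ n) x) \<epsilon>)" for n
    using continuous_on_funpow[OF assms(1,2), of n] assms(3)
    by (intro continuous_closed_preimage) (auto intro: compact_imp_closed)
  then have "compact (X \<inter> (\<Inter>n. X \<inter> (f ^^ n) -` cball ((f ^^ n) x) \<epsilon>))"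
    using assms(3) by (intro compact_Int_closed closed_INT) auto
  moreover have "Phi X f \<epsilon> x = X \<inter> (\<Inter>n. X \<inter> (f ^^ n) -` cball ((f ^^ n) x) \<epsilon>)"
    by (auto simp: Phi_def)
  ultimately show ?thesis by simp
qed

lemma span_card_attained:
  fixes f :: "'a::metric_space \<Rightarrow> 'a"
  assumes "continuous_on X f" "f ` X \<subseteq> X" "compact K" "K \<subseteq> X" "n \<ge> 1" "\<delta> > 0"
  shows "\<exists>E\<subseteq>X. finite E \<and> card E = span_card X f n \<delta> K \<and> spans f n \<delta> E K"
  unfolding span_card_def
  by (rule LeastI_ex) (use finite_span_exists[OF assms] in blast)

text \<open>
  Every finite itinerary through the branches is realised: pull the point \<open>p\<close> back along the word,
  one branch at a time. Starting from a fixed point makes the whole orbit stay in \<open>S\<close>, so that no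
  limit of nested preimages has to be taken.
\<close>

lemma itinerary_realised:
  fixes f :: "'a \<Rightarrow> 'a"
  assumes L: "\<And>i. i \<in> I \<Longrightarrow> L i \<subseteq> S" "\<And>i. i \<in> I \<Longrightarrow> S \<subseteq> f ` L i"
    and p: "p \<in> S" "f p = p"
    and w: "set w \<subseteq> I"
  shows "\<exists>x. (\<forall>n. (f ^^ n) x \<in> S) \<and> (\<forall>k<length w. (f ^^ k) x \<in> L (w ! k))"
  using w
proof (induction w)
  case Nil
  have "(f ^^ n) p = p" for n by (induction n) (simp_all add: p)
  then show ?case using p by (intro exI[of _ p]) auto
next
  case (Cons i w)
  then obtain y where y: "\<And>n. (f ^^ n) y \<in> S" "\<And>k. k < length w \<Longrightarrow> (f ^^ k) y \<in> L (w ! k)"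
    by auto
  have "y \<in> S" using y(1)[of 0] by simp
  then obtain x where x: "x \<in> L i" "f x = y" using L(2)[of i] Cons.prems by auto
  have shift: "(f ^^ Suc k) x = (f ^^ k) y" for k
    by (simp add: funpow_swap1 x(2))
  have "(f ^^ n) x \<in> S" for n
    using x(1) L(1)[of i] Cons.prems y(1) shift by (cases n) (auto simp del: funpow.simps(2))
  moreover have "(f ^^ k) x \<in> L ((i # w) ! k)" if "k < length (i # w)" for k
    using that x(1) y(2) shift by (cases k) (auto simp del: funpow.simps(2))
  ultimately show ?case by blast
qed

text \<open>
  Points with different itineraries are at some time in different branches, hence at Bowen distance
  at least \<open>g\<close>. A ball of radius \<open>\<delta> \<le> g / 2\<close> thus meets at most one itinerary, and a spanning set
  has at least as many points as there are words.
\<close>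

lemma horseshoe_span_card:
  fixes f :: "'a::metric_space \<Rightarrow> 'a"
  assumes f: "continuous_on X f" "f ` X \<subseteq> X" and K: "compact K" "K \<subseteq> X"
    and L: "\<And>i. i \<in> I \<Longrightarrow> L i \<subseteq> S" "\<And>i. i \<in> I \<Longrightarrow> S \<subseteq> f ` L i"
    and I: "finite I"
    and sep: "\<And>i j x y. i \<in> I \<Longrightarrow> j \<in> I \<Longrightarrow> i \<noteq> j \<Longrightarrow> x \<in> L i \<Longrightarrow> y \<in> L j \<Longrightarrow> g \<le> dist x y"
    and p: "p \<in> S" "f p = p"
    and SK: "\<And>x. (\<forall>n. (f ^^ n) x \<in> S) \<Longrightarrow> x \<in> K"
    and n: "n \<ge> 1" and \<delta>: "0 < \<delta>" "\<delta> \<le> g / 2"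
  shows "card I ^ n \<le> span_card X f n \<delta> K"
proof -
  define W where "W = {w. set w \<subseteq> I \<and> length w = n}"
  have "\<forall>w\<in>W. \<exists>x. (\<forall>n. (f ^^ n) x \<in> S) \<and> (\<forall>k<n. (f ^^ k) x \<in> L (w ! k))"
    unfolding W_def using itinerary_realised[of I L S f p] L p by blast
  then obtain x where x: "\<And>w. w \<in> W \<Longrightarrow> (\<forall>n. (f ^^ n) (x w) \<in> S)"
    "\<And>w k. w \<in> W \<Longrightarrow> k < n \<Longrightarrow> (f ^^ k) (x w) \<in> L (w ! k)"
    by metis
  obtain E where E: "finite E" "card E = span_card X f n \<delta> K" "spans f n \<delta> E K"
    using span_card_attained[OF f K n \<delta>(1)] by blast
  have "\<forall>w\<in>W. \<exists>y\<in>E. bowen_dist f n (x w) y < \<delta>"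
    using E(3) x(1) SK unfolding spans_def by blast
  then obtain y where y: "\<And>w. w \<in> W \<Longrightarrow> y w \<in> E" "\<And>w. w \<in> W \<Longrightarrow> bowen_dist f n (x w) (y w) < \<delta>"
    by metis
  have near: "dist ((f ^^ k) (x w)) ((f ^^ k) (y w)) < \<delta>" if "w \<in> W" "k < n" for w k
    using y(2)[OF that(1)] that(2) n
    by (auto simp: bowen_dist_def Max_less_iff lessThan_empty_iff)
  have "inj_on y W"
  proof (rule inj_onI, rule ccontr)
    fix v w assume vw: "v \<in> W" "w \<in> W" "y v = y w" "v \<noteq> w"
    then obtain k where k: "k < n" "v ! k \<noteq> w ! k"
      unfolding W_def by (auto simp: list_eq_iff_nth_eq)
    have I': "v ! k \<in> I" "w ! k \<in> I"
      using vw(1,2) k(1) nth_mem[of k v] nth_mem[of k w] by (auto simp: W_def)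
    have "g \<le> dist ((f ^^ k) (x v)) ((f ^^ k) (x w))"
      using sep[OF I' k(2)] x(2) vw k(1) by blast
    also have "\<dots> \<le> dist ((f ^^ k) (x v)) ((f ^^ k) (y v)) + dist ((f ^^ k) (x w)) ((f ^^ k) (y v))"
      by (rule dist_triangle2)
    also have "\<dots> < \<delta> + \<delta>"
      using near[OF vw(1) k(1)] near[OF vw(2) k(1)] vw(3) by auto
    finally show False using \<delta>(2) by simp
  qed
  then have "card W \<le> card E"
    using card_inj_on_le[of y W E] y(1) E(1) by blast
  then show ?thesis using card_lists_length_eq[OF I, of n] E(2) by (simp add: W_def)
qed

lemma horseshoe_entropy:
  fixes f :: "'a::metric_space \<Rightarrow> 'a"
  assumes f: "continuous_on X f" "f ` X \<subseteq> X" and K: "compact K" "K \<subseteq> X"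
    and L: "\<And>i. i \<in> I \<Longrightarrow> L i \<subseteq> S" "\<And>i. i \<in> I \<Longrightarrow> S \<subseteq> f ` L i"
    and I: "finite I" "I \<noteq> {}" and g: "g > 0"
    and sep: "\<And>i j x y. i \<in> I \<Longrightarrow> j \<in> I \<Longrightarrow> i \<noteq> j \<Longrightarrow> x \<in> L i \<Longrightarrow> y \<in> L j \<Longrightarrow> g \<le> dist x y"
    and p: "p \<in> S" "f p = p"
    and SK: "\<And>x. (\<forall>n. (f ^^ n) x \<in> S) \<Longrightarrow> x \<in> K"
  shows "ereal (ln (real (card I))) \<le> entropy_on X f K"
proof (rule tendsto_lowerbound[OF tendsto_entropy_on[OF f K]])
  have "ereal (ln (real (card I))) \<le> span_rate X f \<delta> K" if \<delta>: "0 < \<delta>" "\<delta> < g / 2" for \<delta>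
    unfolding span_rate_def
  proof (rule le_Limsup, simp, rule eventually_sequentiallyI[of 1])
    fix n :: nat assume n: "1 \<le> n"
    have c: "card I > 0" using I by (simp add: card_gt_0_iff)
    have "card I ^ n \<le> span_card X f n \<delta> K"
      using horseshoe_span_card[OF f K L I(1) sep p SK n \<delta>(1)] \<delta>(2) by simp
    then have "real (card I) ^ n \<le> real (span_card X f n \<delta> K)"
      by (metis of_nat_le_iff of_nat_power)
    moreover have "0 < real (card I) ^ n" using c by simp
    ultimately have "ln (real (card I) ^ n) \<le> ln (real (span_card X f n \<delta> K))"
      by (intro ln_mono) auto
    then have "real n * ln (real (card I)) \<le> ln (real (span_card X f n \<delta> K))"
      using c by (simp add: ln_realpow)
    then show "ereal (ln (real (card I))) \<le> ereal (1 / real n * ln (real (span_card X f n \<delta> K)))"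
      using n by (simp add: field_simps)
  qed
  then show "\<forall>\<^sub>F \<delta> in at_right 0. ereal (ln (real (card I))) \<le> span_rate X f \<delta> K"
    using g unfolding eventually_at_right_field by (intro exI[of _ "g / 2"]) auto
qed simp

section \<open>Differentiability and the little Zygmund condition\<close>

lemma little_zygmund_if_differentiable:
  fixes f :: "real \<Rightarrow> real"
  assumes "continuous_on {0..1} f"
    and D: "\<And>x. x \<in> {0<..<1} \<Longrightarrow> (f has_real_derivative D x) (at x)"
  shows "little_zygmund f"
  unfolding little_zygmund_def
proof (intro conjI ballI assms(1))
  fix x :: real assume "x \<in> {0<..<1}"
  then have right: "((\<lambda>t. (f (x + t) - f x) / t) \<longlongrightarrow> D x) (at 0)"
    using D[of x] by (simp add: DERIV_def)
  have left: "((\<lambda>t. (f (x - t) - f x) / - t) \<longlongrightarrow> D x) (at 0)"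
  proof -
    have "filterlim uminus (at 0) (at (0::real))"
      by (auto simp: filterlim_at eventually_at_filter intro!: tendsto_eq_intros)
    then show ?thesis using filterlim_compose[OF right] by fastforce
  qed
  \<comment> \<open>The second difference divided by \<open>t\<close> is the difference of the two difference quotients.\<close>
  have "((\<lambda>t. (f (x + t) - f x) / t - (f (x - t) - f x) / - t) \<longlongrightarrow> D x - D x) (at 0)"
    by (intro tendsto_intros right left)
  then have "((\<lambda>t. (f (x + t) + f (x - t) - 2 * f x) / t) \<longlongrightarrow> 0) (at 0)"
    by (simp add: diff_divide_distrib add_divide_distrib)
  then have "(\<lambda>t. f (x + t) + f (x - t) - 2 * f x) \<in> o[at 0](\<lambda>t. t)"
    by (rule smalloI_tendsto) (simp add: eventually_at_filter)
  then show "(\<lambda>t. \<bar>f (x + t) + f (x - t) - 2 * f x\<bar>) \<in> o[at 0](\<lambda>t. t)"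
    by simp
qed

section \<open>The model maps are onto\<close>

lemma dyadic_Ioc_cover:
  assumes "0 < y" "y \<le> 1"
  shows "\<exists>n\<ge>1. y \<in> dyadic_Ioc n"
proof -
  define n where "n = (LEAST n. 1 / 2 ^ n < y)"
  obtain k where "(1 / 2 :: real) ^ k < y" using real_arch_pow_inv[of y "1 / 2"] assms by auto
  then have ex: "1 / 2 ^ k < y" by (simp add: power_one_over)
  then have n: "1 / 2 ^ n < y" unfolding n_def by (rule LeastI)
  obtain m where m: "n = Suc m" using n assms(2) by (cases n) auto
  have "\<not> 1 / 2 ^ m < y" using not_less_Least[of m "\<lambda>n. 1 / 2 ^ n < y"] m n_def by auto
  then have "y \<le> 2 / 2 ^ n" by (simp add: m)
  then show ?thesis using n m by (intro exI[of _ n]) (auto simp: dyadic_Ioc_eq)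
qed

text \<open>On each interval of the partition the first lap already maps onto the interval.\<close>

lemma model_map_surj:
  assumes a: "a > 0" and y: "y \<in> {0..1}"
  shows "\<exists>x\<in>{0..1}. model_map a x = y"
proof (cases "y = 0")
  case True
  then show ?thesis by (intro bexI[of _ 0]) (auto simp: model_map_def)
next
  case False
  then obtain n where n: "n \<ge> 1" "y \<in> dyadic_Ioc n" using dyadic_Ioc_cover[of y] y by auto
  define z where "z = dyadic_affine n y"
  define b where "b = 2 * n + 1"
  define v where "v = z powr (1 / a) / real b"
  define x where "x = dyadic_affine_inv n (v powr a)"
  have z: "0 < z" "z \<le> 1"
    using n(2) by (auto simp: z_def dyadic_affine_def dyadic_Ioc_eq field_simps)
  have zp: "0 < z powr (1 / a)" "z powr (1 / a) \<le> 1"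
    using z a by (auto simp: powr_le1)
  have b: "real b \<ge> 1" by (simp add: b_def)
  have v: "0 < v" "v \<le> 1 / real b" "v \<le> 1"
    using zp b by (auto simp: v_def divide_right_mono field_simps)
  have zz: "zigzag b v = z powr (1 / a)"
    using zigzag_eq[of b 0 v] v b by (simp add: v_def)
  have va: "0 < v powr a" "v powr a \<le> 1" using v a by (auto simp: powr_le1)
  have x: "x \<in> dyadic_Ioc n"
    using va by (auto simp: x_def dyadic_affine_inv_def dyadic_Ioc_eq divide_strict_right_mono
        divide_right_mono)
  have "model_map a x = dyadic_affine_inv n (zigzag_pow a b (v powr a))"
    using model_map_eq[OF n(1) x] by (simp add: b_def x_def bij_betw_dyadic_affine)
  also have "zigzag_pow a b (v powr a) = z"
    using v z a powr_inverse_unit by (simp add: zigzag_pow_def zz powr_powr)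
  finally have "model_map a x = y" by (simp add: z_def bij_betw_dyadic_affine)
  moreover have "x \<in> {0..1}"
  proof -
    have "(2::real) ^ 1 \<le> 2 ^ n" using n(1) by (intro power_increasing) auto
    then have "2 / 2 ^ n \<le> (1::real)" by simp
    moreover have "0 < 1 / (2::real) ^ n" by simp
    ultimately show ?thesis using x unfolding dyadic_Ioc_eq
      by (metis atLeastAtMost_iff greaterThanAtMost_iff less_eq_real_def order_trans)
  qed
  ultimately show ?thesis by blast
qed

lemma top_conjugate_surj:
  assumes "top_conjugate X f Y g" "f ` X \<subseteq> X" "Y \<subseteq> g ` Y"
  shows "X \<subseteq> f ` X"
proof
  fix x assume x: "x \<in> X"
  obtain h h' where h: "homeomorphism X Y h h'" "\<And>x. x \<in> X \<Longrightarrow> h (f x) = g (h x)"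
    using assms(1) unfolding top_conjugate_def by blast
  have hX: "h ` X = Y" and h': "\<And>x. x \<in> X \<Longrightarrow> h' (h x) = x"
    using h(1) by (auto simp: homeomorphism_def)
  obtain w where w: "w \<in> X" "g (h w) = h x" using x assms(3) hX by (metis imageE image_eqI subsetD)
  then have "h (f w) = h x" using h(2) by simp
  then have "f w = x" using h' w(1) x assms(2) by (metis image_subset_iff)
  then show "x \<in> f ` X" using w(1) by blast
qed

section \<open>The oscillating map\<close>

text \<open>At \<open>0\<close> the first factor makes the value \<open>0\<close>, whatever \<open>pi / 0\<close> denotes.\<close>

definition osc :: "real \<Rightarrow> real" where
  "osc x = x * (1 - x) * (1 + cos (pi / x))"

lemma osc_bounds:
  assumes "x \<in> {0..1}"
  shows "0 \<le> osc x" "osc x \<le> 1 / 2"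
proof -
  have c: "0 \<le> 1 + cos (pi / x)" "1 + cos (pi / x) \<le> 2"
    using cos_ge_minus_one[of "pi / x"] cos_le_one[of "pi / x"] by linarith+
  have e: "0 \<le> x * (1 - x)" using assms by auto
  show "0 \<le> osc x" unfolding osc_def using c e by simp
  have "0 \<le> (x - 1 / 2)\<^sup>2" by simp
  then have "x * (1 - x) \<le> 1 / 4" by (simp add: power2_eq_square algebra_simps)
  then have "x * (1 - x) * (1 + cos (pi / x)) \<le> 1 / 4 * 2"
    using c e by (intro mult_mono) auto
  then show "osc x \<le> 1 / 2" by (simp add: osc_def)
qed

lemma osc_maps_unit: "osc ` {0..1} \<subseteq> {0..1}"
  using osc_bounds by fastforce

lemma osc_has_derivative:
  assumes "x \<noteq> 0"
  shows "\<exists>D. (osc has_real_derivative D) (at x)"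
  unfolding osc_def using assms
  by (intro exI) (rule derivative_eq_intros refl | simp)+

lemma continuous_osc: "continuous_on UNIV osc"
proof (rule continuous_at_imp_continuous_on, intro ballI)
  fix x :: real
  show "isCont osc x"
  proof (cases "x = 0")
    case False
    then show ?thesis using osc_has_derivative DERIV_isCont by blast
  next
    case True
    have "((\<lambda>x. 2 * \<bar>x * (1 - x)\<bar>) \<longlongrightarrow> 2 * \<bar>0 * (1 - 0)\<bar>) (at (0::real))"
      by (intro tendsto_intros)
    then have lim: "((\<lambda>x. 2 * \<bar>x * (1 - x)\<bar>) \<longlongrightarrow> 0) (at (0::real))" by simp
    have "\<bar>osc x\<bar> \<le> 2 * \<bar>x * (1 - x)\<bar>" for x
    proof -
      have "\<bar>1 + cos (pi / x)\<bar> \<le> 2"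
        using cos_ge_minus_one[of "pi / x"] cos_le_one[of "pi / x"] by linarith
      then have "\<bar>x * (1 - x)\<bar> * \<bar>1 + cos (pi / x)\<bar> \<le> \<bar>x * (1 - x)\<bar> * 2"
        by (intro mult_left_mono) auto
      then show ?thesis by (simp only: osc_def abs_mult[of "x * (1 - x)"] mult.commute[of _ 2])
    qed
    then have "(osc \<longlongrightarrow> 0) (at 0)"
      by (intro Lim_null_comparison[OF _ lim]) (auto simp: real_norm_def)
    then show ?thesis using True by (simp add: isCont_def osc_def)
  qed
qed

lemma osc_at_odd: "osc (1 / real (2 * j + 1)) = 0"
proof -
  have "cos (pi / (1 / real (2 * j + 1))) = -1"
    using cos_npi[of "2 * j + 1"] by (simp add: mult.commute)
  then show ?thesis unfolding osc_def by simp
qed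

lemma osc_at_even:
  assumes "j \<ge> 1"
  shows "osc (1 / real (2 * j)) = 1 / real j * (1 - 1 / real (2 * j))"
proof -
  have "cos (pi / (1 / real (2 * j))) = 1"
    using cos_npi[of "2 * j"] by (simp add: mult.commute)
  then show ?thesis
    unfolding osc_def by (simp only:) (use assms in \<open>simp add: field_simps\<close>)
qed

definition lap :: "nat \<Rightarrow> real set" where
  "lap j = {1 / real (2 * j + 1) .. 1 / real (2 * j)}"

lemma osc_lap_IVT:
  assumes "j \<ge> 1" "0 \<le> y" "y \<le> 1 / real j * (1 - 1 / real (2 * j))"
  shows "y \<in> osc ` lap j"
proof -
  have "1 / real (2 * j + 1) \<le> 1 / real (2 * j)" using assms(1) by (intro divide_left_mono) auto
  moreover have "continuous_on (lap j) osc" using continuous_osc continuous_on_subset by blast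
  ultimately have "\<exists>x. 1 / real (2 * j + 1) \<le> x \<and> x \<le> 1 / real (2 * j) \<and> osc x = y"
    using assms osc_at_odd[of j] osc_at_even[of j] unfolding lap_def by (intro IVT') auto
  then show ?thesis by (auto simp: lap_def)
qed

lemma osc_fixed_point:
  assumes "j \<ge> 1"
  shows "\<exists>p\<in>lap j. osc p = p"
proof -
  let ?l = "1 / real (2 * j + 1)" and ?r = "1 / real (2 * j)"
  have "?l \<le> ?r" using assms by (intro divide_left_mono) auto
  moreover have "osc ?l - ?l \<le> 0" unfolding osc_at_odd by simp
  moreover have "0 \<le> osc ?r - ?r"
    unfolding osc_at_even[OF assms] using assms by (simp add: field_simps)
  moreover have "continuous_on {?l..?r} (\<lambda>x. osc x - x)"
    using continuous_osc by (intro continuous_intros) (blast intro: continuous_on_subset)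
  ultimately have "\<exists>p. ?l \<le> p \<and> p \<le> ?r \<and> osc p - p = 0" by (intro IVT') auto
  then show ?thesis by (auto simp: lap_def)
qed

definition window :: "nat \<Rightarrow> real set" where
  "window m = {1 / real (6 * m) .. 1 / real (4 * m)}"

lemma lap_subset_window:
  assumes "j \<in> {2 * m..<3 * m}"
  shows "lap j \<subseteq> window m"
proof -
  have "1 / real (6 * m) \<le> 1 / real (2 * j + 1)" "1 / real (2 * j) \<le> 1 / real (4 * m)"
    using assms by (intro divide_left_mono; auto)+
  then show ?thesis by (auto simp: lap_def window_def)
qed

text \<open>
  On the window the peaks \<open>1 / j\<close>, up to the factor \<open>1 - x \<ge> 3 / 4\<close>, exceed \<open>1 / (3m)\<close>; the right end
  \<open>1 / (4m)\<close> of the window is exactly \<open>3 / 4\<close> of this.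
\<close>

lemma lap_covers_window:
  assumes "j \<in> {2 * m..<3 * m}"
  shows "window m \<subseteq> osc ` lap j"
proof
  fix y assume y: "y \<in> window m"
  have m: "m \<ge> 1" and j: "j \<ge> 2" using assms by auto
  have "1 / real (3 * m) \<le> 1 / real j" using assms m by (intro divide_left_mono) auto
  moreover have "1 / real (2 * j) \<le> 1 / real 4" using j by (intro divide_left_mono) auto
  then have "3 / 4 \<le> 1 - 1 / real (2 * j)" by simp
  ultimately have "1 / real (3 * m) * (3 / 4) \<le> 1 / real j * (1 - 1 / real (2 * j))"
    by (intro mult_mono) auto
  then have "y \<le> 1 / real j * (1 - 1 / real (2 * j))" using y by (auto simp: window_def)
  moreover have "0 \<le> y" using y by (auto simp: window_def intro: order_trans[rotated])
  ultimately show "y \<in> osc ` lap j" using osc_lap_IVT j by auto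
qed

text \<open>
  Between consecutive laps lies the interval from \<open>1 / (2j + 2)\<close> to \<open>1 / (2j + 1)\<close>, where the map
  falls back to \<open>0\<close>; its length \<open>1 / ((2j + 1) (2j + 2))\<close> is at least \<open>1 / (6m)\<^sup>2\<close> inside the window.
\<close>

lemma laps_separated:
  assumes "i \<in> {2 * m..<3 * m}" "j \<in> {2 * m..<3 * m}" "i \<noteq> j" "x \<in> lap i" "y \<in> lap j"
  shows "1 / (real (6 * m))\<^sup>2 \<le> dist x y"
proof -
  have *: "1 / (real (6 * m))\<^sup>2 \<le> y - x"
    if "j < i" "i < 3 * m" "2 * m \<le> j" "x \<in> lap i" "y \<in> lap j" for i j x y
  proof -
    let ?k = "real (2 * j + 1)"
    have k: "?k > 0" by simp
    have "x \<le> 1 / real (2 * i)" "1 / ?k \<le> y" using that by (auto simp: lap_def)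
    moreover have "1 / real (2 * i) \<le> 1 / (?k + 1)" using that by (intro divide_left_mono) auto
    moreover have "1 / ?k - 1 / (?k + 1) = 1 / (?k * (?k + 1))" using k by (simp add: field_simps)
    moreover have "?k * (?k + 1) \<le> (real (6 * m))\<^sup>2"
      unfolding power2_eq_square using that by (intro mult_mono) auto
    then have "1 / (real (6 * m))\<^sup>2 \<le> 1 / (?k * (?k + 1))" using that by (intro divide_left_mono) auto
    ultimately show ?thesis by linarith
  qed
  show ?thesis
  proof (cases "j < i")
    case True
    then show ?thesis using *[of j i x y] assms by (auto simp: dist_real_def)
  next
    case False
    then show ?thesis using *[of i j y x] assms by (auto simp: dist_real_def)
  qed
qed

lemma osc_entropy_lower_bound:
  assumes m: "m \<ge> 1" and K: "compact K" "K \<subseteq> {0..1}"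
    and WK: "\<And>x. (\<forall>n. (osc ^^ n) x \<in> window m) \<Longrightarrow> x \<in> K"
  shows "ereal (ln (real m)) \<le> entropy_on {0..1} osc K"
proof -
  obtain p where p: "p \<in> lap (2 * m)" "osc p = p" using osc_fixed_point[of "2 * m"] m by auto
  then have "p \<in> window m" using lap_subset_window[of "2 * m" m] m by auto
  then have "ereal (ln (real (card {2 * m..<3 * m}))) \<le> entropy_on {0..1} osc K"
    using m p(2) K WK lap_subset_window lap_covers_window laps_separated
    by (intro horseshoe_entropy[where L = lap and S = "window m" and g = "1 / (real (6 * m))\<^sup>2" and p = p])
      (auto intro: continuous_on_subset[OF continuous_osc] osc_maps_unit[THEN subsetD])
  then show ?thesis by simp
qed

lemma ereal_eq_infty_if_ge_ln:
  fixes c :: ereal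
  assumes "\<And>m::nat. m \<ge> N \<Longrightarrow> ereal (ln (real m)) \<le> c"
  shows "c = \<infinity>"
proof -
  have "ereal (real M) \<le> c" for M :: nat
  proof -
    obtain m :: nat where m: "m \<ge> N" "exp (real M) \<le> real m"
      using real_arch_simple[of "max (real N) (exp (real M))"] by auto
    have "real M \<le> ln (real m)"
      using ln_mono[OF m(2)] by simp
    then show ?thesis using assms[OF m(1)] by (meson ereal_less_eq(3) order_trans)
  qed
  then show ?thesis by (metis ereal_top real_arch_simple ereal_less_eq(3) order_trans)
qed

lemma top_entropy_osc: "top_entropy {0..1} osc = \<infinity>"
proof (rule ereal_eq_infty_if_ge_ln[of 1])
  fix m :: nat assume m: "1 \<le> m"
  have "window m \<subseteq> {0..1}"
  proof -
    have "1 / real (4 * m) \<le> 1 / 1" using m by (intro divide_left_mono) auto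
    moreover have "0 \<le> 1 / real (6 * m)" by simp
    ultimately show ?thesis unfolding window_def by (intro atLeastatMost_subset_iff[THEN iffD2]) auto
  qed
  then have "x \<in> {0..1}" if "\<forall>n. (osc ^^ n) x \<in> window m" for x
    using that[rule_format, of 0] by auto
  then have "ereal (ln (real m)) \<le> entropy_on {0..1} osc {0..1}"
    using osc_entropy_lower_bound[OF m, of "{0..1}"] by auto
  also have "\<dots> \<le> top_entropy {0..1} osc"
    unfolding top_entropy_def by (rule SUP_upper) auto
  finally show "ereal (ln (real m)) \<le> top_entropy {0..1} osc" .
qed

text \<open>
  The points whose orbits stay in the \<open>m\<close>-th window follow the orbit of a fixed point \<open>p\<close> in it at
  distance at most \<open>1 / (4m)\<close>, so for large \<open>m\<close> they all belong to \<open>Phi\<close> at \<open>p\<close>.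
\<close>

lemma local_entropy_osc:
  assumes "\<epsilon> > 0"
  shows "local_entropy {0..1} osc \<epsilon> = \<infinity>"
proof -
  obtain N :: nat where N: "1 / \<epsilon> \<le> real N" using real_arch_simple by blast
  show ?thesis
  proof (rule ereal_eq_infty_if_ge_ln[of "max 1 N"])
    fix m :: nat assume "max 1 N \<le> m"
    then have m: "m \<ge> 1" "N \<le> m" by auto
    then have "1 / \<epsilon> \<le> real m" using N by linarith
    then have small: "1 / real m \<le> \<epsilon>" using assms m(1) by (simp add: field_simps)
    have w: "0 \<le> x \<and> x \<le> 1 / real m" if "x \<in> window m" for x
    proof -
      have "1 / real (4 * m) \<le> 1 / real m" using m by (intro divide_left_mono) auto
      moreover have "0 \<le> 1 / real (6 * m)" by simp
      ultimately show ?thesis using that unfolding window_def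
        by (meson atLeastAtMost_iff order_trans)
    qed
    have one: "1 / real m \<le> 1" using m(1) by simp
    obtain p where p: "p \<in> lap (2 * m)" "osc p = p" using osc_fixed_point[of "2 * m"] m by auto
    then have pw: "p \<in> window m" using lap_subset_window[of "2 * m" m] m by auto
    have pn: "(osc ^^ n) p = p" for n by (induction n) (simp_all add: p)
    have "x \<in> Phi {0..1} osc \<epsilon> p" if x: "\<forall>n. (osc ^^ n) x \<in> window m" for x
    proof -
      have "dist ((osc ^^ n) p) ((osc ^^ n) x) \<le> \<epsilon>" for n
        using w[OF pw] w[OF x[rule_format, of n]] small by (simp add: pn dist_real_def abs_le_iff)
      moreover have "x \<in> {0..1}" using w[OF x[rule_format, of 0, simplified]] one by auto
      ultimately show ?thesis by (simp add: Phi_def)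
    qed
    moreover have "compact (Phi {0..1} osc \<epsilon> p)"
      using osc_maps_unit by (intro compact_Phi) (auto intro: continuous_on_subset[OF continuous_osc])
    ultimately have "ereal (ln (real m)) \<le> entropy_on {0..1} osc (Phi {0..1} osc \<epsilon> p)"
      by (intro osc_entropy_lower_bound[OF m(1)]) (auto simp: Phi_def)
    also have "\<dots> \<le> local_entropy {0..1} osc \<epsilon>"
      unfolding local_entropy_def using w[OF pw] one by (intro SUP_upper) auto
    finally show "ereal (ln (real m)) \<le> local_entropy {0..1} osc \<epsilon>" .
  qed
qed

lemma not_expansive_osc: "\<not> expansive {0..1} osc"
proof
  assume "expansive {0..1} osc"
  then obtain \<epsilon> where \<epsilon>: "\<epsilon> > 0"
    "\<And>x y. x \<in> {0..1} \<Longrightarrow> y \<in> {0..1} \<Longrightarrow>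
      (\<forall>k. dist ((osc ^^ k) x) ((osc ^^ k) y) < \<epsilon>) \<Longrightarrow> x = y"
    unfolding expansive_def by blast
  obtain N :: nat where N: "1 / \<epsilon> \<le> real N" using real_arch_simple by blast
  define j where "j = Suc N"
  have fix_iter: "(osc ^^ k) x = x" if "osc x = x" for x k by (induction k) (simp_all add: that)
  have range: "0 < x \<and> x < \<epsilon> \<and> x \<le> 1" if "x \<in> lap i" "i \<ge> j" for x i
  proof -
    have l: "0 < 1 / real (2 * i + 1)" "1 / real (2 * i + 1) \<le> x" "x \<le> 1 / real (2 * i)"
      using that by (auto simp: lap_def)
    have i: "1 / \<epsilon> < real (2 * i)" "1 \<le> real (2 * i)" using N that(2) by (auto simp: j_def)
    have "1 / real (2 * i) < \<epsilon>" using i \<epsilon>(1) by (simp add: field_simps)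
    moreover have "1 / real (2 * i) \<le> 1" using i(2) by (simp add: field_simps)
    ultimately show ?thesis using l by linarith
  qed
  obtain p where p: "p \<in> lap j" "osc p = p" using osc_fixed_point[of j] by (auto simp: j_def)
  obtain q where q: "q \<in> lap (Suc j)" "osc q = q" using osc_fixed_point[of "Suc j"] by auto
  have "dist ((osc ^^ k) p) ((osc ^^ k) q) < \<epsilon>" for k
    using range[OF p(1)] range[OF q(1)] by (auto simp: fix_iter p q dist_real_def abs_less_iff)
  then have "p = q" using \<epsilon>(2) range[OF p(1)] range[OF q(1)] by auto
  moreover have "q < p"
  proof -
    have "q \<le> 1 / real (2 * Suc j)" "1 / real (2 * j + 1) \<le> p" using p q by (auto simp: lap_def)
    moreover have "1 / real (2 * Suc j) < 1 / real (2 * j + 1)"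
      by (intro divide_strict_left_mono) auto
    ultimately show ?thesis by linarith
  qed
  ultimately show False by simp
qed

theorem theorem2:
  "\<exists>f :: real \<Rightarrow> real.
     continuous_on {0..1} f \<and> f ` {0..1} \<subseteq> {0..1} \<and>
     (\<forall>a\<in>{0<..1}. \<not> top_conjugate {0..1} f {0..1} (model_map a)) \<and>
     top_entropy {0..1} f = \<infinity> \<and>
     \<not> expansive {0..1} f \<and>
     \<not> h_expansive {0..1} f \<and>
     \<not> asymptotically_h_expansive {0..1} f \<and>
     little_zygmund f"
proof (intro exI[of _ osc] conjI ballI)
  show cont: "continuous_on {0..1} osc" using continuous_osc continuous_on_subset by blast
  show "osc ` {0..1} \<subseteq> {0..1}" by (rule osc_maps_unit)
  show "\<not> top_conjugate {0..1} osc {0..1} (model_map a)" if "a \<in> {0<..1}" for a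
  proof
    assume "top_conjugate {0..1} osc {0..1} (model_map a)"
    then have "{0..1} \<subseteq> osc ` {0..1}"
      using model_map_surj[of a] that by (intro top_conjugate_surj[OF _ osc_maps_unit]) force+
    then have "1 \<in> osc ` {0..1}" by auto
    then obtain x where "x \<in> {0..1}" "osc x = 1" by (metis imageE)
    then show False using osc_bounds(2) by fastforce
  qed
  show "top_entropy {0..1} osc = \<infinity>" by (rule top_entropy_osc)
  show "\<not> expansive {0..1} osc" by (rule not_expansive_osc)
  show "\<not> h_expansive {0..1} osc" by (auto simp: h_expansive_def local_entropy_osc)
  show "\<not> asymptotically_h_expansive {0..1} osc"
  proof
    assume "asymptotically_h_expansive {0..1} osc"
    then have "(local_entropy {0..1} osc \<longlongrightarrow> 0) (at_right 0)"
      by (simp add: asymptotically_h_expansive_def)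
    moreover have "(local_entropy {0..1} osc \<longlongrightarrow> \<infinity>) (at_right 0)"
      by (rule tendsto_eventually) (auto simp: local_entropy_osc eventually_at_right_field intro: exI[of _ 1])
    ultimately have "(0::ereal) = \<infinity>" by (intro tendsto_unique) auto
    then show False by simp
  qed
  have "\<forall>x\<in>{0<..<1}. \<exists>D. (osc has_real_derivative D) (at x)"
    using osc_has_derivative by auto
  then obtain D where "\<And>x. x \<in> {0<..<1} \<Longrightarrow> (osc has_real_derivative D x) (at x)" by metis
  then show "little_zygmund osc" by (rule little_zygmund_if_differentiable[OF cont])
qed

end
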